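(* Let $A\subseteq\mathbb N$ be hypersimple. Then for every $n\in\mathbb N$, $\omega\not\leq F_A^{n+}$.
   Context: A ceer is an equivalence relation on $\mathbb N$ c.e. as a subset of $\mathbb N^2$; $R_1\leq R_2$ means there is a total computable $f$ with $xR_1y\Leftrightarrow f(x)R_2f(y)$. $\omega$ is the identity relation on $\mathbb N$. A c.e. set $A$ is hypersimple if its complement is infinite and no computable $f$ satisfies $f(n)\geq z_n$ for all $n$, where $z_0<z_1<\cdots$ enumerates $\mathbb N\setminus A$. For c.e. $A$, $xF_Ay\Leftrightarrow x=y\lor\forall z(\min(x,y)\leq z\leq\max(x,y)\to z\in A)$. The saturation jump $E^+$ of a ceer $E$ is the equivalence relation on finite subsets of $\mathbb N$ (identified with $\mathbb N$ via a fixed computable bijection) given by $xE^+y\Leftrightarrow [x]_E=[y]_E$, where $[X]_E=\{y:\exists x\in X\,(xEy)\}$; $E^{0+}=E$, $E^{(n+1)+}=(E^{n+})^+$. *)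

theory Defs
  imports Main "HOL-Library.Infinite_Set" "HOL-Library.Nat_Bijection"
begin

text \<open>
  Computability is formalised by Kleene's \<open>\<mu>\<close>-recursive functions. Arities are not part of the
  syntax: a program is run on an argument list, and yields no value if the list has an unsuitable
  length.
\<close>

datatype recf =
    Zero
  | Succ
  | Proj nat
  | Comp recf "recf list"
  | PrimRec recf recf
  | Mu recf

inductive evals_to :: "recf \<Rightarrow> nat list \<Rightarrow> nat \<Rightarrow> bool" where
  zero: "evals_to Zero xs 0"
| succ: "evals_to Succ [x] (Suc x)"
| proj: "i < length xs \<Longrightarrow> evals_to (Proj i) xs (xs ! i)"
| comp: "length ys = length gs \<Longrightarrow> (\<forall>i<length gs. evals_to (gs ! i) xs (ys ! i)) \<Longrightarrow>
    evals_to f ys z \<Longrightarrow> evals_to (Comp f gs) xs z"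
| primrec_0: "evals_to f xs z \<Longrightarrow> evals_to (PrimRec f g) (0 # xs) z"
| primrec_Suc: "evals_to (PrimRec f g) (n # xs) y \<Longrightarrow> evals_to g (n # y # xs) z \<Longrightarrow>
    evals_to (PrimRec f g) (Suc n # xs) z"
| mu: "evals_to f (n # xs) 0 \<Longrightarrow> (\<forall>m<n. \<exists>k. evals_to f (m # xs) (Suc k)) \<Longrightarrow>
    evals_to (Mu f) xs n"

lemma evals_to_deterministic:
  "evals_to r xs y \<Longrightarrow> evals_to r xs y' \<Longrightarrow> y = y'"
proof (induction arbitrary: y' rule: evals_to.induct)
  case (comp ys gs xs f z)
  from comp.prems obtain ys' where *: "length ys' = length gs"
    "\<forall>i<length gs. evals_to (gs ! i) xs (ys' ! i)" "evals_to f ys' y'"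
    by (cases rule: evals_to.cases) auto
  have "ys = ys'"
    using comp.hyps comp.IH(1) * by (intro nth_equalityI) auto
  then show ?case using comp.IH(2) * by blast
next
  case (primrec_Suc f g n xs y z)
  from primrec_Suc.prems show ?case
    by (cases rule: evals_to.cases) (use primrec_Suc.IH in blast)
next
  case (mu f n xs)
  from mu.prems have *: "evals_to f (y' # xs) 0" "\<forall>m<y'. \<exists>k. evals_to f (m # xs) (Suc k)"
    by (cases rule: evals_to.cases; auto)+
  have "\<not> n < y'" using mu.IH(1) *(2) by force
  moreover have "\<not> y' < n" using mu.IH(2) *(1) by force
  ultimately show ?case by simp
qed (erule evals_to.cases; auto)+

definition computable :: "(nat \<Rightarrow> nat) \<Rightarrow> bool" where
  "computable f \<longleftrightarrow> (\<exists>r. \<forall>x. evals_to r [x] (f x))"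

definition ce :: "nat set \<Rightarrow> bool" where
  "ce A \<longleftrightarrow> A = {} \<or> (\<exists>f. computable f \<and> A = range f)"

definition hypersimple :: "nat set \<Rightarrow> bool" where
  "hypersimple A \<longleftrightarrow> ce A \<and> infinite (- A) \<and>
     \<not> (\<exists>f. computable f \<and> (\<forall>n. f n \<ge> enumerate (- A) n))"

definition reducible :: "nat rel \<Rightarrow> nat rel \<Rightarrow> bool" where
  "reducible R S \<longleftrightarrow> (\<exists>f. computable f \<and> (\<forall>x y. (x, y) \<in> R \<longleftrightarrow> (f x, f y) \<in> S))"

definition F_rel :: "nat set \<Rightarrow> nat rel" where
  "F_rel A = {(x, y). x = y \<or> (\<forall>z. min x y \<le> z \<and> z \<le> max x y \<longrightarrow> z \<in> A)}"

text \<open>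
  A number \<open>x\<close> stands for the finite set \<open>set_decode x\<close> of the positions of the ones in its binary
  expansion; \<open>E `` X\<close> is the saturation \<open>[X]\<^sub>E\<close>.
\<close>

definition sat_jump :: "nat rel \<Rightarrow> nat rel" where
  "sat_jump E = {(x, y). E `` set_decode x = E `` set_decode y}"

end

theory Submission
  imports Defs
begin

text \<open>
  If only \<open>c\<close> elements of \<open>{..M}\<close> lie outside \<open>A\<close>, then \<open>{..M}\<close> meets at most \<open>2 * c + 2\<close> classes
  of \<open>F_rel A\<close>. Since \<open>set_decode x \<subseteq> {..x}\<close>, each saturation jump at most exponentiates this
  number. Hence, if \<open>f\<close> takes pairwise inequivalent values for the \<open>n\<close>-th jump, more than
  \<open>n\<close>-fold-exponentially many values of \<open>f\<close> below \<open>M\<close> force many elements of \<open>- A\<close> below \<open>M\<close>, and a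
  sum of sufficiently many values of \<open>f\<close> is a computable bound on the enumeration of \<open>- A\<close>.
\<close>

lemma evals_to_Comp1:
  "evals_to g xs y \<Longrightarrow> evals_to f [y] z \<Longrightarrow> evals_to (Comp f [g]) xs z"
  by (rule evals_to.comp[where ys = "[y]"]) auto

lemma evals_to_Comp2:
  "evals_to g xs y \<Longrightarrow> evals_to h xs y' \<Longrightarrow> evals_to f [y, y'] z \<Longrightarrow> evals_to (Comp f [g, h]) xs z"
  by (rule evals_to.comp[where ys = "[y, y']"]) (auto simp: less_Suc_eq)

lemma evals_to_Proj: "i < length xs \<Longrightarrow> y = xs ! i \<Longrightarrow> evals_to (Proj i) xs y"
  using evals_to.proj by simp

definition add_recf :: recf where
  "add_recf = PrimRec (Proj 0) (Comp Succ [Proj 1])"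

lemma evals_to_add_recf: "evals_to add_recf [a, b] (a + b)"
  unfolding add_recf_def
proof (induction a)
  case 0
  show ?case by (auto intro!: evals_to.primrec_0 evals_to_Proj)
next
  case (Suc a)
  show ?case
    by (rule evals_to.primrec_Suc[OF Suc])
      (auto intro!: evals_to_Comp1[where y = "a + b"] evals_to_Proj evals_to.succ)
qed

lemma computable_id: "computable (\<lambda>x. x)"
  unfolding computable_def by (auto intro!: exI[of _ "Proj 0"] evals_to_Proj)

lemma computable_Suc: "computable Suc"
  unfolding computable_def using evals_to.succ by blast

lemma computable_comp:
  assumes "computable f" and "computable g"
  shows "computable (\<lambda>x. f (g x))"
  using assms unfolding computable_def by (meson evals_to_Comp1)

lemma computable_add:
  assumes "computable f" and "computable g"
  shows "computable (\<lambda>x. f x + g x)"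
  using assms unfolding computable_def by (meson evals_to_Comp2 evals_to_add_recf)

lemma computable_power2: "computable (\<lambda>k. 2 ^ k)"
proof -
  \<comment> \<open>\<open>Proj 1\<close> is the previous value in the recursion, so each step
    doubles it, starting from the constant 1.\<close>
  have "evals_to (PrimRec (Comp Succ [Zero]) (Comp add_recf [Proj 1, Proj 1])) [k] (2 ^ k)" for k
  proof (induction k)
    case 0
    show ?case
      using evals_to.succ[of 0]
      by (auto intro!: evals_to.primrec_0 evals_to_Comp1[where y = 0] evals_to.zero)
  next
    case (Suc k)
    show ?case
      using evals_to_add_recf[of "2 ^ k" "2 ^ k"]
      by (intro evals_to.primrec_Suc[OF Suc] evals_to_Comp2[where y = "2 ^ k" and y' = "2 ^ k"])
        (auto simp: mult_2 intro!: evals_to_Proj)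
  qed
  then show ?thesis unfolding computable_def by blast
qed

text \<open>A sum of naturals dominates each summand, so it serves as a computable common bound for
  finitely many values of \<open>f\<close>.\<close>

lemma computable_sum:
  assumes "computable f"
  shows "computable (\<lambda>k. \<Sum>i<k. f i)"
proof -
  obtain r where r: "evals_to r [x] (f x)" for x
    using assms unfolding computable_def by blast
  have "evals_to (PrimRec Zero (Comp add_recf [Proj 1, Comp r [Proj 0]])) [k] (\<Sum>i<k. f i)" for k
  proof (induction k)
    case 0
    show ?case by (auto intro!: evals_to.primrec_0 evals_to.zero)
  next
    case (Suc k)
    show ?case
      using evals_to_add_recf[of "\<Sum>i<k. f i" "f k"]
      by (intro evals_to.primrec_Suc[OF Suc] evals_to_Comp2[where y' = "f k"]
          evals_to_Comp1[where y = k])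
        (auto simp: r intro!: evals_to_Proj)
  qed
  then show ?thesis unfolding computable_def by blast
qed

text \<open>A colouring of \<open>{..M}\<close> with \<open>K\<close> colours stands in for the
  quotient: equal colours force equivalence, while equivalent numbers may still differ in
  colour.\<close>

definition few_classes :: "nat rel \<Rightarrow> nat \<Rightarrow> nat \<Rightarrow> bool" where
  "few_classes E M K \<longleftrightarrow> (\<exists>h::nat \<Rightarrow> nat. h ` {..M} \<subseteq> {..<K} \<and>
     (\<forall>x\<le>M. \<forall>y\<le>M. h x = h y \<longrightarrow> (x, y) \<in> E))"

text \<open>Numbers with the same count \<open>c\<close> run from just after one element of
  \<open>- A\<close> up to and including the next. Only the last of them lies outside
  \<open>A\<close>; the parity of the colour \<open>h\<close> separates it from the rest, which form
  an interval inside \<open>A\<close>.\<close>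

lemma few_classes_F_rel: "few_classes (F_rel A) M (2 * card (- A \<inter> {..M}) + 2)"
proof -
  define c where "c x = card (- A \<inter> {..<x})" for x
  define h where "h x = 2 * c x + (if x \<in> A then 0 else 1)" for x
  have c_less: "c x < c y" if "z \<notin> A" "x \<le> z" "z < y" for x y z
    unfolding c_def using that by (intro psubset_card_mono) (auto dest: le_less_trans)
  have "h x < 2 * card (- A \<inter> {..M}) + 2" if "x \<le> M" for x
  proof -
    have "c x \<le> card (- A \<inter> {..M})"
      unfolding c_def using that by (intro card_mono) auto
    then show ?thesis by (simp add: h_def)
  qed
  moreover have "(x, y) \<in> F_rel A" if "h x = h y" for x y
  proof -
    have same: "x \<in> A \<longleftrightarrow> y \<in> A" and "c x = c y"
      using that unfolding h_def by (auto split: if_splits) presburger+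
    \<comment> \<open>The count says nothing about the right endpoint; if \<open>x\<close> and
      \<open>y\<close> differ, it is in \<open>A\<close> because the left endpoint is and
      \<open>same\<close> transfers membership.\<close>
    then have "z \<in> A" if "min x y \<le> z" "z < max x y" for z
      using c_less[of z x y] c_less[of z y x] that by (auto simp: min_def max_def split: if_splits)
    then show ?thesis
      using same unfolding F_rel_def by (auto simp: min_def max_def le_less split: if_splits)
  qed
  ultimately show ?thesis unfolding few_classes_def by (intro exI[of _ h]) auto
qed

lemma set_encode_less_power2:
  assumes "X \<subseteq> {..<K}"
  shows "set_encode X < 2 ^ K"
proof -
  have "set_encode X \<le> (\<Sum>i<K. 2 ^ i)"
    unfolding set_encode_def using assms by (intro sum_mono2) auto
  also have "\<dots> < 2 ^ K"
    by (induction K) auto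
  finally show ?thesis .
qed

lemma set_decode_le:
  assumes "i \<in> set_decode x"
  shows "i \<le> x"
proof -
  have "2 ^ i \<le> (\<Sum>j\<in>set_decode x. 2 ^ j :: nat)"
    using assms by (intro member_le_sum) auto
  also have "\<dots> = x"
    using set_decode_inverse[of x] by (simp add: set_encode_def)
  finally show ?thesis
    using less_exp[of i] by linarith
qed

text \<open>Colour a finite set by the set of colours of its elements, one of \<open>2 ^ K\<close>
  possibilities. If two sets agree, every element of one has an equally coloured, hence equivalent,
  partner in the other, so the saturations coincide.\<close>

lemma few_classes_sat_jump:
  assumes "sym E" and "trans E" and "few_classes E M K"
  shows "few_classes (sat_jump E) M (2 ^ K)"
proof -
  obtain h where h: "h ` {..M} \<subseteq> {..<K}"
    and E: "\<And>x y. x \<le> M \<Longrightarrow> y \<le> M \<Longrightarrow> h x = h y \<Longrightarrow> (x, y) \<in> E"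
    using assms(3) unfolding few_classes_def by blast
  define h' where "h' x = set_encode (h ` set_decode x)" for x
  have dec: "set_decode x \<subseteq> {..M}" if "x \<le> M" for x
    using set_decode_le that by force
  have sub: "E `` set_decode x \<subseteq> E `` set_decode y" if "x \<le> M" "y \<le> M" "h' x = h' y" for x y
  proof
    fix b assume "b \<in> E `` set_decode x"
    then obtain a where a: "a \<in> set_decode x" "(a, b) \<in> E" by blast
    have "h ` set_decode x = h ` set_decode y"
      using that(3) unfolding h'_def by (metis finite_imageI finite_set_decode set_encode_inverse)
    then obtain a' where a': "a' \<in> set_decode y" "h a' = h a"
      using a(1) by (metis imageE imageI)
    then have "(a', a) \<in> E" using E dec that(1,2) a(1) by blast
    then show "b \<in> E `` set_decode y"
      using a' a(2) assms(2) by (blast dest: transD)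
  qed
  have "h' ` {..M} \<subseteq> {..<2 ^ K}"
    unfolding h'_def using h dec by (auto intro!: set_encode_less_power2)
  moreover have "\<forall>x\<le>M. \<forall>y\<le>M. h' x = h' y \<longrightarrow> (x, y) \<in> sat_jump E"
    unfolding sat_jump_def using sub by (simp add: equalityI)
  ultimately show ?thesis unfolding few_classes_def by blast
qed

lemma sym_F_rel: "sym (F_rel A)"
  unfolding F_rel_def sym_def by (auto simp: min.commute max.commute)

lemma trans_F_rel: "trans (F_rel A)"
proof (rule transI)
  fix x y z
  assume "(x, y) \<in> F_rel A" "(y, z) \<in> F_rel A"
  then show "(x, z) \<in> F_rel A"
    unfolding F_rel_def by (auto simp: min_def max_def split: if_splits) (meson nat_le_linear)+
qed

lemma sym_sat_jump: "sym (sat_jump E)"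
  by (rule symI) (simp add: sat_jump_def)

lemma trans_sat_jump: "trans (sat_jump E)"
  by (rule transI) (simp add: sat_jump_def)

lemma few_classes_iterated_jump:
  assumes "sym E" and "trans E" and "few_classes E M K"
  shows "few_classes ((sat_jump ^^ n) E) M (((\<lambda>k. 2 ^ k) ^^ n) K)"
proof -
  \<comment> \<open>Beyond \<open>n = 0\<close> this holds for any base relation, a jump being
    defined by an equality of saturations.\<close>
  have "sym ((sat_jump ^^ n) E) \<and> trans ((sat_jump ^^ n) E)" for n
    using assms(1,2) by (cases n) (simp_all add: sym_sat_jump trans_sat_jump)
  then show ?thesis
    using assms(3) by (induction n) (simp_all add: few_classes_sat_jump)
qed

text \<open>Pigeonhole: two of the \<open>N\<close> values of \<open>f\<close> with the same colour
  would be equivalent, so their indices agree.\<close>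

lemma few_classes_card_le:
  assumes "few_classes E M K" and "f ` {..<N} \<subseteq> {..M}"
    and "\<And>i j. (f i, f j) \<in> E \<Longrightarrow> i = j"
  shows "N \<le> K"
proof -
  obtain h where h: "h ` {..M} \<subseteq> {..<K}"
    and E: "\<And>x y. x \<le> M \<Longrightarrow> y \<le> M \<Longrightarrow> h x = h y \<Longrightarrow> (x, y) \<in> E"
    using assms(1) unfolding few_classes_def by blast
  have "f i \<le> M" if "i < N" for i
    using assms(2) that by auto
  then have "inj_on (h \<circ> f) {..<N}"
    by (auto intro!: inj_onI intro: assms(3)[OF E])
  moreover have "(h \<circ> f) ` {..<N} \<subseteq> {..<K}"
    using image_mono[OF assms(2), of h] h by (simp add: image_comp)
  ultimately show ?thesis
    by (metis card_inj_on_le card_lessThan finite_lessThan)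
qed

text \<open>Were the element of index \<open>m\<close> beyond \<open>M\<close>, all elements up to
  \<open>M\<close> would have index below \<open>m\<close>; counting from 0, there are only
  \<open>m\<close> such indices.\<close>

lemma enumerate_le_if_card_greater:
  fixes S :: "nat set"
  assumes "infinite S" and "card (S \<inter> {..M}) > m"
  shows "enumerate S m \<le> M"
proof (rule ccontr)
  assume "\<not> enumerate S m \<le> M"
  have "S \<inter> {..M} \<subseteq> enumerate S ` {..<m}"
  proof
    fix x assume x: "x \<in> S \<inter> {..M}"
    then obtain k where k: "x = enumerate S k"
      using enumerate_Ex[OF assms(1), of x] by auto
    then have "enumerate S k < enumerate S m"
      using x \<open>\<not> enumerate S m \<le> M\<close> by simp
    then have "k < m"
      using enumerate_mono_iff[OF assms(1)] by simp
    then show "x \<in> enumerate S ` {..<m}"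
      using k by simp
  qed
  then have "card (S \<inter> {..M}) \<le> m"
    by (metis card_lessThan finite_lessThan surj_card_le)
  with assms(2) show False by simp
qed

theorem theorem7p10:
  fixes A :: "nat set"
  assumes "hypersimple A"
  shows "\<forall>n::nat. \<not> reducible Id ((sat_jump ^^ n) (F_rel A))"
proof (intro allI notI)
  fix n
  define E where "E = (sat_jump ^^ n) (F_rel A)"
  define T where "T = (\<lambda>k::nat. 2 ^ k :: nat) ^^ n"
  assume "reducible Id ((sat_jump ^^ n) (F_rel A))"
  then obtain f where f: "computable f" and inj: "\<And>i j. (f i, f j) \<in> E \<Longrightarrow> i = j"
    unfolding reducible_def E_def by auto
  \<comment> \<open>If at most \<open>m\<close> elements of \<open>- A\<close> were below the bound,
    there would be at most \<open>T (2 * m + 2)\<close> colours; one more value of \<open>f\<close>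
    than that rules this out.\<close>
  define g where "g m = (\<Sum>i<Suc (T (Suc (Suc (m + m)))). f i)" for m
  have "computable T"
    unfolding T_def
  proof (induction n)
    case 0
    show ?case using computable_id by (simp add: id_def)
  next
    case (Suc n)
    show ?case using computable_comp[OF computable_power2 Suc] by (simp add: o_def)
  qed
  then have "computable (\<lambda>m. Suc (T (Suc (Suc (m + m)))))"
    by (rule computable_comp[OF computable_Suc computable_comp[OF _
          computable_comp[OF computable_Suc computable_comp[OF computable_Suc
          computable_add[OF computable_id computable_id]]]]])
  then have "computable g"
    unfolding g_def by (rule computable_comp[OF computable_sum[OF f]])
  moreover have "enumerate (- A) m \<le> g m" for m
  proof (rule enumerate_le_if_card_greater)
    show "infinite (- A)" using assms by (simp add: hypersimple_def)
    let ?c = "card (- A \<inter> {..g m})"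
    have "f i \<le> g m" if "i < Suc (T (Suc (Suc (m + m))))" for i
      unfolding g_def using that by (intro member_le_sum) auto
    moreover have "few_classes E (g m) (T (2 * ?c + 2))"
      unfolding E_def T_def
      by (intro few_classes_iterated_jump sym_F_rel trans_F_rel few_classes_F_rel)
    ultimately have "Suc (T (Suc (Suc (m + m)))) \<le> T (2 * ?c + 2)"
      using inj by (intro few_classes_card_le[where f = f]) auto
    moreover have "mono T"
      unfolding T_def by (intro mono_pow monoI) simp
    ultimately show "m < ?c"
      using monoD[of T "2 * ?c + 2" "Suc (Suc (m + m))"] by (cases "m < ?c") auto
  qed
  ultimately show False
    using assms unfolding hypersimple_def by blast
qed

end
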